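(* Let $\mu$ be a nonzero finite positive Borel measure on $\mathbb{R}^d$, and let $\Lambda\subset\mathbb{R}^d$ be a countable set such that for some $A>0$, $$A\int|f(x)|^2\,d\mu(x)\le\sum_{\lambda\in\Lambda}\left|\int f(x)e^{-2\pi i\lambda\cdot x}\,d\mu(x)\right|^2\qquad\text{for all } f\in L^2(\mu).$$ Suppose there exist $C>0$ and $0<\gamma\le d$ such that $$|\widehat{\mu}(\xi)|\le C|\xi|^{-\gamma/2}\qquad\text{for all } \xi\in\mathbb{R}^d \text{ with } |\xi|>1.$$ Then $$\sum_{\lambda\in\Lambda\setminus\{0\}}\frac{1}{|\lambda|^{\gamma}}=\infty.$$
   Context: The Fourier transform of a finite Borel measure $\mu$ on $\mathbb{R}^d$ is $\widehat{\mu}(\xi)=\int e^{-2\pi i\xi\cdot x}\,d\mu(x)$. The sums over $\Lambda$ are sums of nonnegative terms, with values in $[0,\infty]$. *)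

theory Defs
  imports "HOL-Analysis.Analysis"
begin

text \<open>Complex-valued square-integrable functions (as functions, not as classes modulo
  almost-everywhere equality).\<close>

definition L2_functions :: "'a measure \<Rightarrow> ('a \<Rightarrow> complex) set" where
  "L2_functions M = {f \<in> borel_measurable M. integrable M (\<lambda>x. (cmod (f x))\<^sup>2)}"

definition fourier_measure :: "(real ^ 'd) measure \<Rightarrow> real ^ 'd \<Rightarrow> complex" where
  "fourier_measure M \<xi> =
     (\<integral>x. exp (- 2 * complex_of_real pi * \<i> * complex_of_real (\<xi> \<bullet> x)) \<partial>M)"

end

theory Submission
  imports Defs
begin

text \<open>Testing the frame inequality on the characters \<open>x \<mapsto> exp (2 \<pi> \<i> \<xi> \<bullet> x)\<close> gives
  \<open>A \<mu>(\<real>\<^sup>d) \<le> K \<Sum> min 1 (\<bar>l - \<xi>\<bar>\<^sup>-\<^sup>\<gamma>)\<close>, summed over \<open>l \<in> \<Lambda>\<close>, for every \<open>\<xi>\<close>. If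
  \<open>\<Sum> \<bar>l\<bar>\<^sup>-\<^sup>\<gamma>\<close> converges, this is contradicted by a \<open>\<xi>\<close> of size comparable to \<open>8\<^sup>m\<close> that makes the
  sum small. Finitely many \<open>l\<close> contribute little as \<open>\<xi> \<rightarrow> \<infinity>\<close>; those with
  \<open>2 \<bar>l - \<xi>\<bar> \<ge> \<bar>l\<bar>\<close> are controlled by the tail of the convergent series; the others lie in the
  shell \<open>8\<^sup>m < \<bar>l\<bar> \<le> 8\<^sup>m\<^sup>+\<^sup>1\<close>, and averaging over \<open>\<xi>\<close> in a ball of radius \<open>8\<^sup>m\<close> bounds their
  contribution by a constant times \<open>(m + 2) s\<^sub>m\<close>, where \<open>s\<^sub>m\<close> is the part of the series in the shell.
  The factor \<open>m + 2\<close> is the logarithm that occurs for \<open>\<gamma> = d\<close>. It is harmless, because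
  \<open>\<Sum> s\<^sub>m < \<infinity>\<close> and the harmonic series diverges, so \<open>(m + 2) s\<^sub>m\<close> is small for infinitely many
  \<open>m\<close>.\<close>

section \<open>Averaging weighted indicators of balls\<close>

text \<open>Some value on \<open>cball c R\<close> does not exceed the mean over that ball. The mean
  of the \<open>i\<close>-th indicator is at most the volume ratio
  \<open>(r i / R) ^ DIM('a)\<close>, because integrating over the whole space only enlarges
  it.\<close>

lemma exists_point_weighted_balls_le:
  fixes a :: "'i \<Rightarrow> 'a::euclidean_space" and w r :: "'i \<Rightarrow> real"
  assumes "finite I" and w: "\<And>i. i \<in> I \<Longrightarrow> 0 \<le> w i" and r: "\<And>i. i \<in> I \<Longrightarrow> 0 \<le> r i" and R: "0 < R"
  shows "\<exists>\<xi>\<in>cball c R. (\<Sum>i\<in>I. w i * indicator (cball (a i) (r i)) \<xi>) \<le> (\<Sum>i\<in>I. w i * (r i / R) ^ DIM('a))"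
proof (rule ccontr)
  define g where "g = (\<lambda>\<xi>. \<Sum>i\<in>I. w i * indicator (cball (a i) (r i)) \<xi>)"
  define t where "t = (\<Sum>i\<in>I. w i * (r i / R) ^ DIM('a))"
  define V where "V = unit_ball_vol (real DIM('a)) * R ^ DIM('a)"
  have V: "V > 0" unfolding V_def using R by simp
  assume "\<not> ?thesis"
  then have "\<forall>\<xi>\<in>cball c R. t < g \<xi>"
    unfolding g_def t_def by (simp only: bex_simps not_le)
  then have gt: "t < g \<xi>" if "\<xi> \<in> cball c R" for \<xi>
    using that by blast
  have meas: "measure lborel (cball x s) = unit_ball_vol (real DIM('a)) * s ^ DIM('a)" if "0 \<le> s" for x :: 'a and s
    using that by (rule content_cball)
  have icball: "integrable lborel (indicator (cball x s) :: 'a \<Rightarrow> real)" for x s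
    by (intro integrable_real_indicator emeasure_lborel_cball_finite) simp
  have ig: "integrable lborel g"
    unfolding g_def by (intro Bochner_Integration.integrable_sum integrable_mult_right icball)
  have "(\<integral>x. g x \<partial>lborel) = (\<Sum>i\<in>I. w i * measure lborel (cball (a i) (r i)))"
    unfolding g_def
    by (subst Bochner_Integration.integral_sum) (simp_all add: icball integrable_mult_right)
  also have "\<dots> = (\<Sum>i\<in>I. w i * (r i / R) ^ DIM('a) * V)"
    unfolding V_def using R by (intro sum.cong refl) (simp only: meas r, simp add: power_divide)
  also have "\<dots> = t * V"
    unfolding t_def sum_distrib_right ..
  finally have int: "(\<integral>x. g x \<partial>lborel) = t * V" .
  \<comment> \<open>Under the negated claim \<open>?k\<close> is nonnegative with integral at most
    0, so it vanishes almost everywhere; as it is positive on the ball, the ball would be a null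
    set.\<close>
  let ?k = "\<lambda>x. (g x - t) * indicator (cball c R) x"
  have igb: "integrable lborel (\<lambda>x. g x * indicator (cball c R) x)"
    by (rule integrable_real_mult_indicator) (auto intro: ig)
  have ik: "integrable lborel ?k"
    unfolding left_diff_distrib by (intro Bochner_Integration.integrable_diff igb integrable_mult_right icball)
  have g0: "0 \<le> g x" for x unfolding g_def by (intro sum_nonneg mult_nonneg_nonneg w) auto
  have "(\<integral>x. ?k x \<partial>lborel) = (\<integral>x. g x * indicator (cball c R) x \<partial>lborel) - t * V"
    unfolding left_diff_distrib V_def using R meas[of R c]
    by (subst Bochner_Integration.integral_diff) (auto intro: igb integrable_mult_right icball)
  also have "(\<integral>x. g x * indicator (cball c R) x \<partial>lborel) \<le> (\<integral>x. g x \<partial>lborel)"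
    by (rule integral_mono[OF igb ig]) (use g0 in \<open>auto simp: indicator_def\<close>)
  finally have le0: "(\<integral>x. ?k x \<partial>lborel) \<le> 0" using int by simp
  have nn: "0 \<le> ?k x" for x using gt[of x] by (auto simp: indicator_def)
  have "(\<integral>x. ?k x \<partial>lborel) = 0"
    using le0 Bochner_Integration.integral_nonneg[of lborel ?k] nn by (meson antisym)
  then have "AE x in lborel. ?k x = 0"
    using integral_nonneg_eq_0_iff_AE[OF ik] nn by auto
  then have "AE x in lborel. x \<notin> cball c R"
    by eventually_elim (use gt in \<open>force simp: indicator_def\<close>)
  then have "emeasure lborel (cball c R) = 0"
    by (subst (asm) AE_iff_measurable[where N="cball c R"]) auto
  then have "measure lborel (cball c R) = 0"
    unfolding measure_def by simp
  then show False
    using V R meas[of R c] by (simp only: V_def)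
qed

section \<open>Truncated power decay and its decomposition into scales\<close>

text \<open>The value at the origin has to be prescribed, since \<open>0 powr - \<gamma> = 0\<close>.\<close>

definition decay :: "real \<Rightarrow> 'a::real_normed_vector \<Rightarrow> real" where
  "decay \<gamma> x = (if norm x \<le> 1 then 1 else norm x powr - \<gamma>)"

lemma decay_nonneg: "0 \<le> decay \<gamma> x"
  by (simp add: decay_def)

lemma decay_le_powr:
  assumes "0 < \<gamma>" "0 < b" "b \<le> norm x"
  shows "decay \<gamma> x \<le> b powr - \<gamma>"
proof (cases "norm x \<le> 1")
  case True
  then have "b \<le> 1" using assms by simp
  then show ?thesis using True assms powr_mono2'[of "- \<gamma>" b 1] by (simp add: decay_def)
next
  case False
  then show ?thesis using assms by (auto simp: decay_def intro: powr_mono2')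
qed

text \<open>One term is enough: for the least \<open>j\<close> with
  \<open>norm x \<le> 8 ^ j\<close>, either \<open>j = 0\<close> or
  \<open>norm x > 8 ^ (j - 1)\<close>, which explains the exponent \<open>1 - j\<close>. Ball
  indicators are the form in which averaging applies.\<close>

lemma decay_le_sum_balls:
  fixes x :: "'a::real_normed_vector"
  assumes "0 < \<gamma>" and "norm x \<le> 8 ^ n"
  shows "decay \<gamma> x \<le> (\<Sum>j\<le>n. 8 powr (\<gamma> * (1 - real j)) * indicator (cball 0 (8 ^ j)) x)"
proof -
  define j where "j = (LEAST j. norm x \<le> 8 ^ j)"
  have j: "norm x \<le> 8 ^ j" unfolding j_def using assms(2) by (rule LeastI)
  have jn: "j \<le> n" unfolding j_def using assms(2) by (rule Least_le)
  have "decay \<gamma> x \<le> 8 powr (\<gamma> * (1 - real j))"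
  proof (cases j)
    case 0
    then have "decay \<gamma> x = 1" using j by (simp add: decay_def)
    then show ?thesis using 0 assms(1) by (simp add: ge_one_powr_ge_zero)
  next
    case (Suc i)
    then have "\<not> norm x \<le> 8 ^ i" unfolding j_def using not_less_Least by (metis lessI)
    then have "decay \<gamma> x \<le> (8 ^ i) powr - \<gamma>"
      by (intro decay_le_powr assms) auto
    also have "\<dots> = 8 powr (\<gamma> * (1 - real j))"
      using Suc by (simp add: powr_realpow[symmetric] powr_powr algebra_simps)
    finally show ?thesis .
  qed
  also have "\<dots> = 8 powr (\<gamma> * (1 - real j)) * indicator (cball 0 (8 ^ j)) x"
    using j by simp
  also have "\<dots> \<le> (\<Sum>j\<le>n. 8 powr (\<gamma> * (1 - real j)) * indicator (cball 0 (8 ^ j)) x)"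
    by (rule member_le_sum) (use jn in auto)
  finally show ?thesis .
qed

text \<open>Averaging is applied to the balls indexed by pairs of a centre \<open>l\<close> and a
  scale \<open>j\<close>. Each of the \<open>m + 2\<close> scales contributes at most
  \<open>8 ^ DIM('a) * 8 powr (- \<gamma> * real m)\<close> per centre.\<close>

lemma exists_point_sum_decay_le:
  fixes F :: "'a::euclidean_space set"
  assumes "finite F" "0 < \<gamma>" "\<gamma> \<le> real DIM('a)"
  shows "\<exists>\<xi>\<in>cball c (8 ^ m). (\<Sum>l\<in>{l\<in>F. dist l \<xi> \<le> 8 ^ Suc m}. decay \<gamma> (l - \<xi>))
     \<le> 8 ^ DIM('a) * (real m + 2) * (real (card F) * 8 powr (- \<gamma> * real m))"
proof -
  let ?w = "\<lambda>j. 8 powr (\<gamma> * (1 - real j))"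
  obtain \<xi> where \<xi>: "\<xi> \<in> cball c (8 ^ m)"
    and le: "(\<Sum>i\<in>F \<times> {..Suc m}. ?w (snd i) * indicator (cball (fst i) (8 ^ snd i)) \<xi>)
      \<le> (\<Sum>i\<in>F \<times> {..Suc m}. ?w (snd i) * (8 ^ snd i / 8 ^ m) ^ DIM('a))"
    using exists_point_weighted_balls_le[of "F \<times> {..Suc m}" "\<lambda>i. ?w (snd i)" "\<lambda>i. 8 ^ snd i" "8 ^ m" c fst]
      assms(1) by auto
  have "(\<Sum>l\<in>{l\<in>F. dist l \<xi> \<le> 8 ^ Suc m}. decay \<gamma> (l - \<xi>))
      \<le> (\<Sum>l\<in>{l\<in>F. dist l \<xi> \<le> 8 ^ Suc m}. \<Sum>j\<le>Suc m. ?w j * indicator (cball l (8 ^ j)) \<xi>)"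
  proof (rule sum_mono)
    fix l assume "l \<in> {l\<in>F. dist l \<xi> \<le> 8 ^ Suc m}"
    then have "decay \<gamma> (l - \<xi>) \<le> (\<Sum>j\<le>Suc m. ?w j * indicator (cball 0 (8 ^ j)) (l - \<xi>))"
      by (intro decay_le_sum_balls assms) (auto simp: dist_norm)
    then show "decay \<gamma> (l - \<xi>) \<le> (\<Sum>j\<le>Suc m. ?w j * indicator (cball l (8 ^ j)) \<xi>)"
      by (simp add: indicator_def dist_norm norm_minus_commute del: sum.atMost_Suc)
  qed
  also have "\<dots> \<le> (\<Sum>l\<in>F. \<Sum>j\<le>Suc m. ?w j * indicator (cball l (8 ^ j)) \<xi>)"
    by (rule sum_mono2) (use assms in \<open>auto intro!: sum_nonneg add_nonneg_nonneg\<close>)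
  also have "\<dots> \<le> (\<Sum>l\<in>F. \<Sum>j\<le>Suc m. ?w j * (8 ^ j / 8 ^ m) ^ DIM('a))"
    using le by (simp only: sum.cartesian_product case_prod_unfold)
  also have "\<dots> \<le> (\<Sum>l\<in>F. \<Sum>j\<le>Suc m. 8 ^ DIM('a) * 8 powr (- \<gamma> * real m))"
  proof (intro sum_mono)
    fix j assume "j \<in> {..Suc m}"
    \<comment> \<open>Weight times volume ratio has an exponent nondecreasing in \<open>j\<close>,
      as \<open>\<gamma> \<le> real DIM('a)\<close>; the worst scale is thus
      \<open>j = Suc m\<close>, where this product vanishes.\<close>
    then have "(real j - 1 - real m) * (real DIM('a) - \<gamma>) \<le> 0"
      using assms(3) by (intro mult_nonpos_nonneg) auto
    then have *: "\<gamma> * (1 - real j) + (real j - real m) * real DIM('a) \<le> real DIM('a) + - \<gamma> * real m"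
      by (simp add: algebra_simps)
    have "?w j * (8 ^ j / 8 ^ m) ^ DIM('a) = 8 powr (\<gamma> * (1 - real j) + (real j - real m) * real DIM('a))"
      by (simp add: powr_add powr_realpow[symmetric] powr_diff[symmetric] powr_powr powr_power)
    also have "\<dots> \<le> 8 powr (real DIM('a) + - \<gamma> * real m)"
      using * by simp
    also have "\<dots> = 8 ^ DIM('a) * 8 powr (- \<gamma> * real m)"
      by (simp only: powr_add) (simp add: powr_realpow)
    finally show "?w j * (8 ^ j / 8 ^ m) ^ DIM('a) \<le> 8 ^ DIM('a) * 8 powr (- \<gamma> * real m)" .
  qed
  also have "\<dots> = 8 ^ DIM('a) * (real m + 2) * (real (card F) * 8 powr (- \<gamma> * real m))"
    by (simp add: algebra_simps)
  finally show ?thesis using \<xi> by blast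
qed

lemma nonneg_summable_exists_less_divide:
  fixes s :: "nat \<Rightarrow> real"
  assumes "summable s" "0 < \<epsilon>"
  shows "\<exists>m\<ge>N. s m < \<epsilon> / (real m + 2)"
proof (rule ccontr)
  assume "\<not> ?thesis"
  then have "\<epsilon> * (1 / (real m + 2)) \<le> s m" if "m \<ge> N" for m using that by (auto simp: not_less)
  then have "summable (\<lambda>m. \<epsilon> * (1 / (real m + 2)))"
    by (intro summable_comparison_test'[OF assms(1), of N]) (use assms(2) in auto)
  then have "summable (\<lambda>m. 1 / (real m + 2))"
    by (rule summable_mult_D) (use assms(2) in simp)
  then have "summable (\<lambda>m. inverse (real (m + 2)))" by (simp add: inverse_eq_divide add.commute)
  then show False
    using not_summable_harmonic[where 'a=real] summable_iff_shift[of "\<lambda>n. inverse (real n)" 2] by simp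
qed

section \<open>A translate with small total decay\<close>

lemma exists_point_sum_decay_less:
  fixes \<Lambda> :: "'a::euclidean_space set"
  assumes \<gamma>: "0 < \<gamma>" "\<gamma> \<le> real DIM('a)" and \<epsilon>: "0 < \<epsilon>"
    and summable: "(\<lambda>l. norm l powr - \<gamma>) summable_on \<Lambda> - {0}"
  shows "\<exists>\<xi>. \<forall>F. finite F \<longrightarrow> F \<subseteq> \<Lambda> \<longrightarrow> (\<Sum>l\<in>F. decay \<gamma> (l - \<xi>)) < \<epsilon>"
proof -
  define p :: "'a \<Rightarrow> real" where "p = (\<lambda>l. norm l powr - \<gamma>)"
  \<comment> \<open>Three pieces will each be at most \<open>\<delta>\<close>; a quarter instead of
    a third makes the final inequality strict.\<close>
  define \<delta> where "\<delta> = \<epsilon> / 4"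
  have \<delta>: "\<delta> > 0" using \<epsilon> by (simp add: \<delta>_def)
  have p0: "0 \<le> p l" for l by (simp add: p_def)
  define S where "S = infsum p (\<Lambda> - {0})"
  have sum_le: "sum p F \<le> S" if "finite F" "F \<subseteq> \<Lambda> - {0}" for F
    unfolding S_def using that summable by (intro finite_sum_le_infsum) (auto simp: p0 p_def)
  \<comment> \<open>The factor \<open>2 powr \<gamma>\<close> is the loss in replacing
    \<open>norm (l - \<xi>)\<close> by \<open>norm l / 2\<close>.\<close>
  define \<eta> where "\<eta> = \<delta> / 2 powr \<gamma>"
  have \<eta>: "\<eta> > 0" using \<delta> by (simp add: \<eta>_def)
  obtain F0 where F0: "finite F0" "F0 \<subseteq> \<Lambda> - {0}" "dist (sum p F0) S \<le> \<eta>"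
    using infsum_finite_approximation[OF summable \<eta>] unfolding p_def S_def by blast
  have tail: "sum p F \<le> \<eta>" if "finite F" "F \<subseteq> \<Lambda> - {0} - F0" for F
  proof -
    have "sum p F0 + sum p F = sum p (F0 \<union> F)"
      using that F0 by (intro sum.union_disjoint[symmetric]) auto
    also have "\<dots> \<le> S" using that F0 by (intro sum_le) auto
    finally show ?thesis using F0(3) by (simp add: dist_real_def)
  qed
  define shell where "shell = (\<lambda>m. {l\<in>\<Lambda>. 8 ^ m < norm l \<and> norm l \<le> 8 ^ Suc m})"
  have shell_sub: "shell m \<subseteq> \<Lambda> - {0}" for m unfolding shell_def by (auto simp: not_less)
  have card_le: "real (card F) * 8 powr (- \<gamma> * real (Suc m)) \<le> sum p F" if "F \<subseteq> shell m" for F m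
  proof -
    have "real (card F) * 8 powr (- \<gamma> * real (Suc m)) = (\<Sum>l\<in>F. 8 powr (- \<gamma> * real (Suc m)))" by simp
    also have "\<dots> \<le> sum p F"
    proof (rule sum_mono)
      fix l assume "l \<in> F"
      then have l: "8 ^ m < norm l" "norm l \<le> 8 ^ Suc m" using that by (auto simp: shell_def)
      have "8 powr (- \<gamma> * real (Suc m)) = (8 ^ Suc m) powr - \<gamma>"
        by (simp only: powr_realpow[symmetric] zero_less_numeral powr_powr mult.commute)
      also have "\<dots> \<le> p l"
        unfolding p_def using l \<gamma> by (intro powr_mono2') (auto intro: le_less_trans[of _ "8 ^ m"])
      finally show "8 powr (- \<gamma> * real (Suc m)) \<le> p l" .
    qed
    finally show ?thesis .
  qed
  \<comment> \<open>Local finiteness comes from convergence: each point of a shell adds at least the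
    fixed amount \<open>?q\<close> to a sum bounded by \<open>S\<close>.\<close>
  have fin: "finite (shell m)" for m
  proof (rule ccontr)
    let ?q = "8 powr (- \<gamma> * real (Suc m))"
    assume inf: "infinite (shell m)"
    obtain n where n: "S / ?q < real n" using reals_Archimedean2 by blast
    obtain F where F: "finite F" "card F = n" "F \<subseteq> shell m"
      using infinite_arbitrarily_large[OF inf] by blast
    have "real n * ?q \<le> S"
      using order_trans[OF card_le[OF F(3)] sum_le[OF F(1) order_trans[OF F(3) shell_sub]]] unfolding F(2) .
    then show False using n by (simp add: pos_divide_less_eq)
  qed
  have "summable (\<lambda>m. sum p (shell m))"
  proof (rule summableI_nonneg_bounded)
    fix n
    have *: "shell i \<inter> shell j = {}" if "i < j" for i j
    proof -
      have "(8::real) ^ Suc i \<le> 8 ^ j" using that by (intro power_increasing) auto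
      then show ?thesis by (fastforce simp: shell_def)
    qed
    have "(\<Sum>m<n. sum p (shell m)) = sum p (\<Union>m<n. shell m)"
    proof (rule sum.UNION_disjoint[symmetric])
      show "\<forall>i\<in>{..<n}. \<forall>j\<in>{..<n}. i \<noteq> j \<longrightarrow> shell i \<inter> shell j = {}"
        using * by (metis inf_commute linorder_neqE_nat)
    qed (auto simp: fin)
    also have "\<dots> \<le> S" using shell_sub by (intro sum_le) (auto simp: fin)
    finally show "(\<Sum>m<n. sum p (shell m)) \<le> S" .
  qed (simp add: p0 sum_nonneg)
  note shell_summable = this
  \<comment> \<open>The origin may belong to \<open>\<Lambda>\<close> but is absent from the series,
    so it joins the finitely many exceptional points.\<close>
  define F1 where "F1 = insert 0 F0"
  have F1: "finite F1" using F0 by (simp add: F1_def)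
  obtain B where B: "\<And>l. l \<in> F1 \<Longrightarrow> norm l \<le> B"
    using finite_imp_bounded[OF F1] unfolding bounded_iff by blast
  have "(\<lambda>m. real (card F1) * (8 powr - \<gamma>) ^ m) \<longlonglongrightarrow> real (card F1) * 0"
    using \<gamma> by (intro tendsto_mult tendsto_const LIMSEQ_power_zero) (simp add: powr_less_one)
  then have "\<forall>\<^sub>F m in sequentially. real (card F1) * (8 powr - \<gamma>) ^ m < \<delta>"
    using \<delta> by (simp add: order_tendstoD)
  moreover obtain n0 where n0: "B < 8 ^ n0" using real_arch_pow[of 8 B] by auto
  have "B \<le> 8 ^ m" if "m \<ge> n0" for m
    using n0 power_increasing[OF that, of "8::real"] by linarith
  then have "\<forall>\<^sub>F m in sequentially. B \<le> 8 ^ m"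
    by (rule eventually_sequentiallyI)
  ultimately obtain N where N: "\<And>m. m \<ge> N \<Longrightarrow> real (card F1) * (8 powr - \<gamma>) ^ m < \<delta> \<and> B \<le> 8 ^ m"
    unfolding eventually_sequentially by (meson le_cases order_trans)
  \<comment> \<open>The denominator cancels the averaging constant and the factor
    \<open>8 powr \<gamma>\<close> lost by bounding \<open>p\<close> on the shell at its outer
    radius \<open>8 ^ Suc m\<close>.\<close>
  define \<theta> where "\<theta> = \<delta> / (8 ^ DIM('a) * 8 powr \<gamma>)"
  obtain m where m: "m \<ge> N" "sum p (shell m) < \<theta> / (real m + 2)"
    using nonneg_summable_exists_less_divide[OF shell_summable, of \<theta> N] \<delta> by (auto simp: \<theta>_def)
  \<comment> \<open>The ball of radius \<open>8 ^ m\<close> about \<open>c\<close> then lies between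
    radii \<open>2 * 8 ^ m\<close> and \<open>4 * 8 ^ m\<close>, hence at distance at least
    \<open>8 ^ m\<close> from \<open>F1\<close>.\<close>
  obtain c :: 'a where c: "norm c = 3 * 8 ^ m" using vector_choose_size[of "3 * 8 ^ m"] by auto
  obtain \<xi> where \<xi>: "dist c \<xi> \<le> 8 ^ m"
    and le: "(\<Sum>l\<in>{l\<in>shell m. dist l \<xi> \<le> 8 ^ Suc m}. decay \<gamma> (l - \<xi>))
     \<le> 8 ^ DIM('a) * (real m + 2) * (real (card (shell m)) * 8 powr (- \<gamma> * real m))"
    using exists_point_sum_decay_le[OF fin \<gamma>, of c m m] by (auto simp: mem_cball)
  have norm_\<xi>: "2 * 8 ^ m \<le> norm \<xi>" "norm \<xi> \<le> 4 * 8 ^ m"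
    using \<xi> c norm_triangle_ineq2[of c \<xi>] norm_triangle_ineq2[of \<xi> c]
    by (auto simp: dist_norm norm_minus_commute)
  have near: "(\<Sum>l\<in>{l\<in>shell m. dist l \<xi> \<le> 8 ^ Suc m}. decay \<gamma> (l - \<xi>)) \<le> \<delta>"
  proof -
    note le
    also have "real (card (shell m)) * 8 powr (- \<gamma> * real m)
        = 8 powr \<gamma> * (real (card (shell m)) * 8 powr (- \<gamma> * real (Suc m)))"
      by (simp add: powr_add[symmetric] algebra_simps)
    also have "\<dots> \<le> 8 powr \<gamma> * (\<theta> / (real m + 2))"
      using card_le[of "shell m" m] m(2) by (intro mult_left_mono) auto
    also have "8 ^ DIM('a) * (real m + 2) * (8 powr \<gamma> * (\<theta> / (real m + 2))) = \<delta>"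
      unfolding \<theta>_def by (simp add: add_nonneg_eq_0_iff)
    finally show ?thesis by (simp add: mult_left_mono)
  qed
  have F1_le: "(\<Sum>l\<in>F1. decay \<gamma> (l - \<xi>)) \<le> \<delta>"
  proof -
    have "(\<Sum>l\<in>F1. decay \<gamma> (l - \<xi>)) \<le> (\<Sum>l\<in>F1. (8 powr - \<gamma>) ^ m)"
    proof (rule sum_mono)
      fix l assume "l \<in> F1"
      then have "8 ^ m \<le> norm (l - \<xi>)"
        using B N[OF m(1)] norm_\<xi>(1) norm_triangle_ineq2[of \<xi> l] by (fastforce simp: norm_minus_commute)
      then have "decay \<gamma> (l - \<xi>) \<le> (8 ^ m) powr - \<gamma>" by (intro decay_le_powr \<gamma>) auto
      also have "\<dots> = (8 powr - \<gamma>) ^ m" by (simp add: powr_realpow[symmetric] powr_powr mult.commute)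
      finally show "decay \<gamma> (l - \<xi>) \<le> (8 powr - \<gamma>) ^ m" .
    qed
    then show ?thesis using N[OF m(1)] by simp
  qed
  have "(\<Sum>l\<in>F. decay \<gamma> (l - \<xi>)) < \<epsilon>" if F: "finite F" "F \<subseteq> \<Lambda>" for F
  proof -
    let ?G = "{l \<in> F - F1. norm l \<le> 2 * dist l \<xi>}"
    let ?N = "{l \<in> shell m. dist l \<xi> \<le> 8 ^ Suc m}"
    have sub: "F \<subseteq> F1 \<union> ?G \<union> ?N"
    proof
      fix l assume l: "l \<in> F"
      show "l \<in> F1 \<union> ?G \<union> ?N"
      proof (cases "l \<in> F1 \<or> norm l \<le> 2 * dist l \<xi>")
        \<comment> \<open>From \<open>2 * dist l \<xi> < norm l\<close> follow
          \<open>norm l < 2 * norm \<xi>\<close> and \<open>norm \<xi> < 3 / 2 * norm l\<close>.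
          With the bounds on \<open>norm \<xi>\<close> this puts \<open>l\<close> in the shell of
          ratio 8.\<close>
        case False
        moreover have "norm l \<le> norm \<xi> + dist l \<xi>" "norm \<xi> \<le> norm l + dist l \<xi>"
          using norm_triangle_ineq2[of l \<xi>] norm_triangle_ineq2[of \<xi> l]
          by (auto simp: dist_norm norm_minus_commute)
        moreover have "(0::real) < 8 ^ m" by simp
        ultimately have "8 ^ m < norm l" "norm l \<le> 8 * 8 ^ m" "dist l \<xi> \<le> 8 * 8 ^ m"
          using norm_\<xi> by linarith+
        then show ?thesis using l F by (auto simp: shell_def)
      qed (use l in auto)
    qed
    have "(\<Sum>l\<in>?G. decay \<gamma> (l - \<xi>)) \<le> (\<Sum>l\<in>?G. 2 powr \<gamma> * p l)"
    proof (rule sum_mono)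
      fix l assume l: "l \<in> ?G"
      then have "l \<noteq> 0" by (auto simp: F1_def)
      then have "decay \<gamma> (l - \<xi>) \<le> (norm l / 2) powr - \<gamma>"
        using l by (intro decay_le_powr \<gamma>) (auto simp: dist_norm)
      also have "\<dots> = 2 powr \<gamma> * p l" by (simp add: p_def powr_divide powr_minus field_simps)
      finally show "decay \<gamma> (l - \<xi>) \<le> 2 powr \<gamma> * p l" .
    qed
    also have "\<dots> \<le> 2 powr \<gamma> * \<eta>"
      unfolding sum_distrib_left[symmetric]
      by (intro mult_left_mono tail) (use F in \<open>auto simp: F1_def\<close>)
    also have "\<dots> = \<delta>" by (simp add: \<eta>_def)
    finally have far: "(\<Sum>l\<in>?G. decay \<gamma> (l - \<xi>)) \<le> \<delta>" .
    have "(\<Sum>l\<in>F. decay \<gamma> (l - \<xi>)) \<le> (\<Sum>l\<in>F1 \<union> ?G \<union> ?N. decay \<gamma> (l - \<xi>))"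
      by (rule sum_mono2) (use sub F1 F fin decay_nonneg in auto)
    also have "\<dots> \<le> (\<Sum>l\<in>F1 \<union> ?G. decay \<gamma> (l - \<xi>)) + (\<Sum>l\<in>?N. decay \<gamma> (l - \<xi>))"
      using F1 F fin by (subst sum_Un) (auto simp: decay_nonneg sum_nonneg)
    also have "\<dots> \<le> (\<Sum>l\<in>F1. decay \<gamma> (l - \<xi>)) + (\<Sum>l\<in>?G. decay \<gamma> (l - \<xi>)) + (\<Sum>l\<in>?N. decay \<gamma> (l - \<xi>))"
      using F1 F by (subst sum_Un) (auto simp: decay_nonneg sum_nonneg)
    also have "\<dots> \<le> 3 * \<delta>" using near far F1_le by linarith
    also have "\<dots> < \<epsilon>" using \<epsilon> by (simp add: \<delta>_def)
    finally show ?thesis .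
  qed
  then show ?thesis by blast
qed

section \<open>Testing the frame inequality on characters\<close>

lemma cmod_exp_two_pi_i: "cmod (exp (- 2 * complex_of_real pi * \<i> * complex_of_real t)) = 1"
  by (simp add: norm_exp_eq_Re)

theorem theorem1p3:
  fixes \<mu> :: "(real ^ 'd) measure"
    and \<Lambda> :: "(real ^ 'd) set"
    and A C \<gamma> :: real
  assumes "finite_measure \<mu>"
    and "sets \<mu> = sets borel"
    and "emeasure \<mu> UNIV \<noteq> 0"
    and "countable \<Lambda>"
    and "A > 0"
    and "\<forall>f \<in> L2_functions \<mu>.
           ennreal (A * (\<integral>x. (cmod (f x))\<^sup>2 \<partial>\<mu>))
             \<le> (\<Sum>\<^sub>\<infinity>l\<in>\<Lambda>. ennreal ((cmod (\<integral>x. f x *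
                    exp (- 2 * complex_of_real pi * \<i> * complex_of_real (l \<bullet> x)) \<partial>\<mu>))\<^sup>2))"
    and "C > 0"
    and "0 < \<gamma>"
    and "\<gamma> \<le> real CARD('d)"
    and "\<forall>\<xi>. norm \<xi> > 1 \<longrightarrow> cmod (fourier_measure \<mu> \<xi>) \<le> C * norm \<xi> powr (- \<gamma> / 2)"
  shows "(\<Sum>\<^sub>\<infinity>l\<in>\<Lambda> - {0}. ennreal (1 / norm l powr \<gamma>)) = \<infinity>"
proof (rule ccontr)
  interpret finite_measure \<mu> by fact
  have space: "space \<mu> = UNIV" using sets_eq_imp_space_eq[OF assms(2)] by simp
  define M where "M = measure \<mu> UNIV"
  have M: "M > 0" unfolding M_def using assms(3) by (simp add: emeasure_eq_measure zero_less_measure_iff)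
  \<comment> \<open>\<open>M\<^sup>2\<close> covers the unit ball, where the transform is bounded by
    the total mass; \<open>C\<^sup>2\<close> covers the decay outside it.\<close>
  define K where "K = max (C\<^sup>2) (M\<^sup>2)"
  have K: "K > 0" unfolding K_def using M by (simp add: less_max_iff_disj)
  have bound: "(cmod (fourier_measure \<mu> x))\<^sup>2 \<le> K * decay \<gamma> x" for x
  proof (cases "norm x \<le> 1")
    case True
    have "cmod (fourier_measure \<mu> x) \<le> (\<integral>y. 1 \<partial>\<mu>)"
      unfolding fourier_measure_def
      by (rule order_trans[OF integral_norm_bound]) (simp only: cmod_exp_two_pi_i order_refl)
    then have "cmod (fourier_measure \<mu> x) \<le> M" by (simp add: M_def space)
    then have "(cmod (fourier_measure \<mu> x))\<^sup>2 \<le> M\<^sup>2" by (intro power_mono) auto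
    also have "\<dots> \<le> K" by (simp add: K_def)
    finally show ?thesis using True by (simp add: decay_def)
  next
    case False
    then have "(cmod (fourier_measure \<mu> x))\<^sup>2 \<le> (C * norm x powr (- \<gamma> / 2))\<^sup>2"
      using assms(10) by (intro power_mono) auto
    also have "\<dots> = C\<^sup>2 * norm x powr - \<gamma>"
      by (simp add: power_mult_distrib power2_eq_square powr_add[symmetric])
    also have "\<dots> \<le> K * norm x powr - \<gamma>" by (intro mult_right_mono) (auto simp: K_def)
    finally show ?thesis using False by (simp add: decay_def)
  qed
  assume "\<not> ?thesis"
  then have fin: "(\<Sum>\<^sub>\<infinity>l\<in>\<Lambda> - {0}. ennreal (norm l powr - \<gamma>)) < \<infinity>"
    by (simp add: powr_minus inverse_eq_divide less_top)
  have "(\<lambda>l. norm l powr - \<gamma>) summable_on \<Lambda> - {0}"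
  proof (rule nonneg_bdd_above_summable_on)
    let ?T = "\<Sum>\<^sub>\<infinity>l\<in>\<Lambda> - {0}. ennreal (norm l powr - \<gamma>)"
    have "(\<Sum>l\<in>F. norm l powr - \<gamma>) \<le> enn2real ?T" if F: "finite F" "F \<subseteq> \<Lambda> - {0}" for F
    proof -
      have "ennreal (\<Sum>l\<in>F. norm l powr - \<gamma>) = (\<Sum>l\<in>F. ennreal (norm l powr - \<gamma>))"
        by (simp add: sum_ennreal)
      also have "\<dots> \<le> ?T"
        by (subst nonneg_infsum_complete) (use F in \<open>auto intro!: SUP_upper\<close>)
      also have "\<dots> = ennreal (enn2real ?T)" using fin by simp
      finally show ?thesis by (simp add: ennreal_le_iff)
    qed
    then show "bdd_above (sum (\<lambda>l. norm l powr - \<gamma>) ` {F. F \<subseteq> \<Lambda> - {0} \<and> finite F})"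
      by (intro bdd_aboveI2) auto
  qed auto
  \<comment> \<open>After multiplication by \<open>K\<close> this threshold becomes
    \<open>A * M / 2\<close>, half of the lower frame bound for a function of modulus 1.\<close>
  from exists_point_sum_decay_less[OF assms(8) _ _ this, of "A * M / (2 * K)"] assms(5,9) M K
  obtain \<xi> where \<xi>: "\<And>F. finite F \<Longrightarrow> F \<subseteq> \<Lambda> \<Longrightarrow> (\<Sum>l\<in>F. decay \<gamma> (l - \<xi>)) < A * M / (2 * K)"
    by auto
  \<comment> \<open>Modulation by \<open>\<xi>\<close> translates the transform: the coefficient of
    \<open>f\<close> at \<open>l\<close> is
    \<open>fourier_measure \<mu> (l - \<xi>)\<close>.\<close>
  define f where "f = (\<lambda>x. exp (- 2 * complex_of_real pi * \<i> * complex_of_real ((- \<xi>) \<bullet> x)))"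
  have cf: "cmod (f x) = 1" for x unfolding f_def by (rule cmod_exp_two_pi_i)
  have [measurable]: "f \<in> borel_measurable \<mu>"
    unfolding measurable_cong_sets[OF assms(2) refl] f_def by measurable
  have "f \<in> L2_functions \<mu>" by (simp add: L2_functions_def cf)
  then have "ennreal (A * (\<integral>x. (cmod (f x))\<^sup>2 \<partial>\<mu>))
             \<le> (\<Sum>\<^sub>\<infinity>l\<in>\<Lambda>. ennreal ((cmod (\<integral>x. f x *
                    exp (- 2 * complex_of_real pi * \<i> * complex_of_real (l \<bullet> x)) \<partial>\<mu>))\<^sup>2))"
    using assms(6) by blast
  also have "(\<integral>x. (cmod (f x))\<^sup>2 \<partial>\<mu>) = M" by (simp add: cf M_def space)
  also have "(\<lambda>l. \<integral>x. f x * exp (- 2 * complex_of_real pi * \<i> * complex_of_real (l \<bullet> x)) \<partial>\<mu>)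
      = (\<lambda>l. fourier_measure \<mu> (l - \<xi>))"
    unfolding fourier_measure_def f_def exp_add[symmetric]
    by (simp add: inner_diff_left algebra_simps)
  also have "(\<Sum>\<^sub>\<infinity>l\<in>\<Lambda>. ennreal ((cmod (fourier_measure \<mu> (l - \<xi>)))\<^sup>2)) \<le> ennreal (A * M / 2)"
  proof (rule infsum_le_finite_sums)
    fix F assume F: "finite F" "F \<subseteq> \<Lambda>"
    have "(\<Sum>l\<in>F. (cmod (fourier_measure \<mu> (l - \<xi>)))\<^sup>2) \<le> K * (\<Sum>l\<in>F. decay \<gamma> (l - \<xi>))"
      unfolding sum_distrib_left by (intro sum_mono bound)
    also have "\<dots> \<le> K * (A * M / (2 * K))"
      using \<xi>[OF F] K by (intro mult_left_mono) auto
    also have "\<dots> = A * M / 2" using K by simp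
    finally show "(\<Sum>l\<in>F. ennreal ((cmod (fourier_measure \<mu> (l - \<xi>)))\<^sup>2)) \<le> ennreal (A * M / 2)"
      by (simp add: sum_ennreal ennreal_leI)
  qed (auto intro: nonneg_summable_on_complete)
  finally show False using assms(5) M by (simp add: ennreal_le_iff)
qed

end
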